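(* Let $n\ge2$, $\alpha\in\mathbb{Z}_{\ge1}^n$, $d:=\sum_j\alpha_j$, let $S\subseteq[0,1]^n$ be a compact convex set with $\mathbf 1\in S$, and let $\mathcal{B}\subseteq\mathbf 1+\mathbb{R}^n_+$ with $\alpha\in\mathcal{B}$. Let $$P_{\mathcal{B}}:=\Big\{(x,w)\in[0,1]^n\times\mathbb{R}\;\Big|\; f^{cvx}_{\mathcal{B}}(x)\le w\le\min_{j=1,\dots,n}x_j\Big\}.$$ Then $$\mu(P_{\mathcal{B}})=\Big(1-\frac1d\Big)d^{\frac1{1-d}}.$$
   Context: $\mathbf 1\in\mathbb{R}^n$ is the all-ones vector; $x^\alpha=\prod_jx_j^{\alpha_j}$. For a set $X\subseteq\mathbb{R}^n\times\mathbb{R}$, $\mu(X):=\max_{(x,w)\in X}|w-x^\alpha|$. For $\beta\in\mathcal{B}$, $$\sigma(\beta):=\min_{x\in S}\Big(x^\alpha-\sum_{j=1}^n\beta_j(x_j-1)\Big),$$ and $$f^{cvx}_{\mathcal{B}}(x):=\max\Big\{0,\ \sup_{\beta\in\mathcal{B}}\ \sigma(\beta)+\sum_{j=1}^n\beta_j(x_j-1)\Big\}.$$ *)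

theory Defs
  imports "HOL-Analysis.Analysis"
begin

definition mono_pow :: "real ^ 'n \<Rightarrow> nat ^ 'n \<Rightarrow> real" where
  "mono_pow x \<alpha> = (\<Prod>j\<in>UNIV. (x $ j) ^ (\<alpha> $ j))"

definition real_vec :: "nat ^ 'n \<Rightarrow> real ^ 'n" where
  "real_vec \<alpha> = (\<chi> j. real (\<alpha> $ j))"

text \<open>The real supremum stands for the maximum only when the latter exists; a theorem about
  \<open>mu \<alpha> X\<close> should therefore also assert that the maximum is attained.\<close>
definition mu :: "nat ^ 'n \<Rightarrow> ((real ^ 'n) \<times> real) set \<Rightarrow> real" where
  "mu \<alpha> X = (SUP (x, w)\<in>X. \<bar>w - mono_pow x \<alpha>\<bar>)"

text \<open>For compact nonempty \<open>S\<close> the infimum is a minimum, the objective being continuous.\<close>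
definition sigma :: "nat ^ 'n \<Rightarrow> (real ^ 'n) set \<Rightarrow> real ^ 'n \<Rightarrow> real" where
  "sigma \<alpha> S \<beta> = (INF x\<in>S. mono_pow x \<alpha> - (\<Sum>j\<in>UNIV. \<beta> $ j * (x $ j - 1)))"

text \<open>\<open>B\<close> may be unbounded. If \<open>S\<close> is compact and contains the all-ones vector \<open>1\<close>, then
  \<open>sigma \<alpha> S \<beta> \<le> 1\<close>; hence for \<open>x\<close> in the unit cube and \<open>\<beta> \<ge> 0\<close> all values below are at
  most \<open>1\<close>, and for nonempty \<open>B\<close> the real supremum is the true, finite one.\<close>
definition f_cvx :: "nat ^ 'n \<Rightarrow> (real ^ 'n) set \<Rightarrow> (real ^ 'n) set \<Rightarrow> real ^ 'n \<Rightarrow> real" where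
  "f_cvx \<alpha> S B x = max 0 (SUP \<beta>\<in>B. sigma \<alpha> S \<beta> + (\<Sum>j\<in>UNIV. \<beta> $ j * (x $ j - 1)))"

text \<open>\<open>cbox 0 1\<close> is the cube \<open>[0,1]\<^sup>n\<close>, since \<open>1 :: real ^ 'n\<close> is the all-ones vector.\<close>
definition P_set :: "nat ^ 'n \<Rightarrow> (real ^ 'n) set \<Rightarrow> (real ^ 'n) set \<Rightarrow> ((real ^ 'n) \<times> real) set" where
  "P_set \<alpha> S B = {(x, w). x \<in> cbox 0 1 \<and> f_cvx \<alpha> S B x \<le> w \<and> w \<le> Min (range (\<lambda>j. x $ j))}"

end

theory Submission
  imports Defs
begin

text \<open>Put \<open>M = (1 - 1/d) d powr (1/(1-d))\<close>, the maximum of \<open>t - t^d\<close> on \<open>[0,1]\<close>, attained at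
  \<open>t = d powr (1/(1-d))\<close>. If \<open>w\<close> lies above \<open>x\<^sup>\<alpha>\<close>, then \<open>m = Min x\<^sub>j\<close> satisfies \<open>w \<le> m\<close> and
  \<open>x\<^sup>\<alpha> \<ge> m^d\<close>, so the gap is at most \<open>M\<close>. If \<open>w\<close> lies below \<open>x\<^sup>\<alpha>\<close>, the cut for
  \<open>\<beta> = \<alpha>\<close>, for which \<open>\<sigma>(\<alpha>) \<ge> 1\<close> by Bernoulli, and the AM-GM inequality reduce the gap to
  \<open>u^d - max 0 (1 - d + d u)\<close>, where \<open>u\<close> is the \<open>\<alpha>\<close>-weighted mean of \<open>x\<close>; this is largest at
  \<open>u = 1 - 1/d\<close>, where it does not exceed \<open>M\<close>, again by Bernoulli. The diagonal point
  \<open>(t, \<dots>, t)\<close> with \<open>w = t\<close> attains \<open>M\<close>: every \<open>\<beta> \<in> B\<close> has entries at least \<open>1\<close> and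
  \<open>\<sigma>(\<beta>) \<le> 1\<close>, so \<open>f_cvx\<close> is at most \<open>1 + n (t - 1) \<le> t\<close> there.\<close>

section \<open>Inequalities for products and powers of reals\<close>

text \<open>Bernoulli in several variables. Induction adds a factor through
  \<open>(1 - p) * (1 - q) \<ge> 0\<close>, that is \<open>p * q \<ge> p + q - 1\<close>.\<close>

lemma prod_power_ge_linear:
  fixes y :: "'a \<Rightarrow> real"
  assumes "finite A" "\<And>j. j \<in> A \<Longrightarrow> 0 \<le> y j" "\<And>j. j \<in> A \<Longrightarrow> y j \<le> 1"
  shows "1 + (\<Sum>j\<in>A. real (a j) * (y j - 1)) \<le> (\<Prod>j\<in>A. y j ^ a j)"
  using assms
proof (induction A rule: finite_induct)
  case (insert k A)
  let ?P = "\<Prod>j\<in>A. y j ^ a j"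
  have "1 + real (a k) * (y k - 1) \<le> y k ^ a k"
    using Bernoulli_inequality[of "y k - 1" "a k"] insert.prems(1)[of k] by simp
  moreover have "1 + (\<Sum>j\<in>A. real (a j) * (y j - 1)) \<le> ?P"
    using insert.IH insert.prems by simp
  moreover have "0 \<le> (1 - y k ^ a k) * (1 - ?P)"
    using insert.prems by (intro mult_nonneg_nonneg) (auto intro!: power_le_one prod_le_1)
  ultimately show ?case using insert.hyps by (simp add: algebra_simps)
qed simp

text \<open>Weighted AM-GM with integer weights. Each factor is bounded by
  \<open>1 + s \<le> exp s\<close> at \<open>s = y j / c - 1\<close>; the weighted exponents sum to
  zero because \<open>c\<close> is the weighted mean.\<close>

lemma prod_power_le_mean_power:
  fixes y :: "'a \<Rightarrow> real"
  assumes fin: "finite A" and y: "\<And>j. j \<in> A \<Longrightarrow> 0 \<le> y j" and d: "d = (\<Sum>j\<in>A. a j)"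
    and c: "real d * c = (\<Sum>j\<in>A. real (a j) * y j)" and "c > 0"
  shows "(\<Prod>j\<in>A. y j ^ a j) \<le> c ^ d"
proof -
  have "(\<Prod>j\<in>A. y j ^ a j) \<le> (\<Prod>j\<in>A. c ^ a j * exp (real (a j) * (y j / c - 1)))"
  proof (rule prod_mono, intro conjI)
    fix j assume j: "j \<in> A"
    have "y j = c * (1 + (y j / c - 1))" using \<open>c > 0\<close> by simp
    also have "\<dots> \<le> c * exp (y j / c - 1)"
      using \<open>c > 0\<close> by (intro mult_left_mono exp_ge_add_one_self) auto
    finally have "y j ^ a j \<le> (c * exp (y j / c - 1)) ^ a j"
      using y[OF j] by (intro power_mono)
    then show "y j ^ a j \<le> c ^ a j * exp (real (a j) * (y j / c - 1))"
      by (simp add: power_mult_distrib exp_of_nat_mult)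
    show "0 \<le> y j ^ a j" using y[OF j] by simp
  qed
  also have "\<dots> = c ^ d * exp (\<Sum>j\<in>A. real (a j) * (y j / c - 1))"
    using fin by (simp add: prod.distrib power_sum d exp_sum)
  also have "(\<Sum>j\<in>A. real (a j) * (y j / c - 1)) = (\<Sum>j\<in>A. real (a j) * y j) / c - real d"
    by (simp add: d algebra_simps sum_subtractf sum_divide_distrib)
  also have "\<dots> = 0" using c[symmetric] \<open>c > 0\<close> by simp
  finally show ?thesis by simp
qed

text \<open>Here \<open>t\<close> is the zero of \<open>1 - d * t ^ (d - 1)\<close>, the derivative
  of \<open>t - t ^ d\<close>.\<close>

lemma critical_point_power:
  assumes "2 \<le> d"
  defines "t \<equiv> real d powr (1 / (1 - real d))"
  shows "t ^ (d - 1) = 1 / real d" "t ^ d = t / real d"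
proof -
  have "t ^ (d - 1) = real d powr (1 / (1 - real d) * real (d - 1))"
    using assms(1) by (simp add: t_def powr_powr flip: powr_realpow)
  also have "1 / (1 - real d) * real (d - 1) = -1"
    using assms(1) by (simp add: of_nat_diff field_simps)
  finally show *: "t ^ (d - 1) = 1 / real d"
    using assms(1) by (simp add: powr_minus divide_simps)
  have "t ^ d = t * t ^ (d - 1)"
    using assms(1) by (cases d) auto
  with * show "t ^ d = t / real d" by simp
qed

text \<open>The tangent to \<open>y ^ d\<close> at \<open>t\<close> has slope 1, so
  \<open>y - y ^ d\<close> is largest at \<open>t\<close>. Bernoulli applied to \<open>y / t\<close>
  gives the tangent bound.\<close>

lemma diff_power_le:
  fixes y :: real
  assumes "2 \<le> d" "0 \<le> y"
  defines "t \<equiv> real d powr (1 / (1 - real d))"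
  shows "y - y ^ d \<le> (1 - 1 / real d) * t"
proof -
  have t: "t > 0" "t ^ d = t / real d"
    using assms critical_point_power(2)[of d] by (auto simp: t_def)
  have "1 + real d * (y / t - 1) \<le> (y / t) ^ d"
    using Bernoulli_inequality[of "y / t - 1" d] assms(2) t(1) by simp
  then have "t ^ d * (1 + real d * (y / t - 1)) \<le> y ^ d"
    using t(1) by (simp add: power_divide field_simps)
  moreover have "t ^ d * (1 + real d * (y / t - 1)) = t / real d + y - t"
    using t assms(1) by (simp add: field_simps)
  ultimately show ?thesis by (simp add: algebra_simps)
qed

text \<open>With \<open>q = 1 - 1/d\<close>, cancelling \<open>q\<close> and raising to the power
  \<open>d - 1\<close> leaves \<open>q ^ ((d-1) * (d-1)) \<le> 1/d\<close>. As
  \<open>1/q = 1 + 1/(d-1)\<close>, Bernoulli with exponent \<open>(d-1) * (d-1)\<close> gives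
  exactly this.\<close>

lemma contact_power_le:
  assumes "2 \<le> d"
  defines "t \<equiv> real d powr (1 / (1 - real d))"
  shows "(1 - 1 / real d) ^ d \<le> (1 - 1 / real d) * t"
proof -
  define q where "q = 1 - 1 / real d"
  have q: "0 < q" using assms(1) by (simp add: q_def)
  have inv: "1 / q = 1 + 1 / real (d - 1)"
    using assms(1) by (simp add: q_def of_nat_diff field_simps)
  have "real d \<le> 1 + real ((d - 1) * (d - 1)) * (1 / real (d - 1))"
    using assms(1) by (simp add: of_nat_diff)
  also have "\<dots> \<le> (1 / q) ^ ((d - 1) * (d - 1))"
    unfolding inv by (rule Bernoulli_inequality) (rule order_trans[of _ 0], auto)
  finally have "real d * q ^ ((d - 1) * (d - 1)) \<le> 1"
    using q by (simp add: power_divide field_simps)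
  then have "q ^ ((d - 1) * (d - 1)) \<le> 1 / real d"
    using assms(1) by (simp add: field_simps)
  then have "(q ^ (d - 1)) ^ (d - 1) \<le> t ^ (d - 1)"
    unfolding t_def critical_point_power(1)[OF assms(1)] by (simp add: power_mult)
  moreover have "0 < d - 1" using assms(1) by simp
  ultimately have "q ^ (d - 1) \<le> t"
    by (subst (asm) power_mono_iff) (use q in \<open>auto simp: t_def\<close>)
  then have "q * q ^ (d - 1) \<le> q * t" using q by (intro mult_left_mono) auto
  moreover have "q * q ^ (d - 1) = q ^ d" using assms(1) by (cases d) auto
  ultimately show ?thesis by (simp add: q_def)
qed

text \<open>The tangent to \<open>u ^ d\<close> at 1 vanishes at \<open>1 - 1/d\<close>. To the
  left, monotonicity suffices; to the right, the tangent rises with slope \<open>d\<close>, and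
  \<open>u ^ d\<close> is \<open>d\<close>-Lipschitz on the unit interval, so the gap cannot
  grow.\<close>

lemma power_diff_tangent_le:
  fixes u :: real
  assumes "1 \<le> d" "0 \<le> u" "u \<le> 1"
  shows "u ^ d - max 0 (1 - real d + real d * u) \<le> (1 - 1 / real d) ^ d"
proof (cases "u \<le> 1 - 1 / real d")
  case True
  then have "u ^ d \<le> (1 - 1 / real d) ^ d" using assms by (intro power_mono) auto
  then show ?thesis by linarith
next
  case False
  have "norm (u ^ d - (1 - 1 / real d) ^ d) \<le> real d * norm (u - (1 - 1 / real d))"
    using assms by (intro norm_power_diff) auto
  also have "norm (u - (1 - 1 / real d)) = u - (1 - 1 / real d)" using False by simp
  also have "real d * (u - (1 - 1 / real d)) = 1 - real d + real d * u"
    using assms by (simp add: field_simps)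
  finally show ?thesis by simp
qed

section \<open>Bounds on \<open>sigma\<close> and on the convex underestimator\<close>

lemma cbox_0_1_cart: "x \<in> cbox 0 (1 :: real ^ 'n) \<longleftrightarrow> (\<forall>j. 0 \<le> x $ j \<and> x $ j \<le> 1)"
  by (simp add: mem_box_cart)

lemma mono_pow_nonneg: "x \<in> cbox 0 1 \<Longrightarrow> 0 \<le> mono_pow x \<alpha>"
  by (auto simp: mono_pow_def cbox_0_1_cart intro!: prod_nonneg)

lemma sigma_le_1:
  fixes S :: "(real ^ 'n) set"
  assumes "S \<subseteq> cbox 0 1" "1 \<in> S" "\<And>j. 0 \<le> \<beta> $ j"
  shows "sigma \<alpha> S \<beta> \<le> 1"
proof -
  have "sigma \<alpha> S \<beta> \<le> mono_pow 1 \<alpha> - (\<Sum>j\<in>UNIV. \<beta> $ j * ((1 :: real ^ 'n) $ j - 1))"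
    unfolding sigma_def
  proof (rule cINF_lower)
    \<comment> \<open>A real infimum lies below its members only if the set is bounded below; 0
      serves as the bound.\<close>
    have "0 \<le> mono_pow x \<alpha> - (\<Sum>j\<in>UNIV. \<beta> $ j * (x $ j - 1))" if "x \<in> S" for x
    proof -
      have x: "x \<in> cbox 0 1" using that assms(1) by auto
      have "(\<Sum>j\<in>UNIV. \<beta> $ j * (x $ j - 1)) \<le> 0"
        using assms(3) x by (intro sum_nonpos) (auto simp: cbox_0_1_cart mult_nonneg_nonpos)
      with mono_pow_nonneg[OF x, of \<alpha>] show ?thesis by linarith
    qed
    then show "bdd_below ((\<lambda>x. mono_pow x \<alpha> - (\<Sum>j\<in>UNIV. \<beta> $ j * (x $ j - 1))) ` S)"
      by (intro bdd_belowI2[where m = 0])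
  qed (rule assms(2))
  then show ?thesis by (simp add: mono_pow_def)
qed

lemma sigma_real_vec_ge_1:
  assumes "S \<subseteq> cbox 0 1" "S \<noteq> {}"
  shows "1 \<le> sigma \<alpha> S (real_vec \<alpha>)"
  unfolding sigma_def
proof (rule cINF_greatest[OF assms(2)])
  fix x assume "x \<in> S"
  then have "x \<in> cbox 0 1" using assms(1) by auto
  then show "1 \<le> mono_pow x \<alpha> - (\<Sum>j\<in>UNIV. real_vec \<alpha> $ j * (x $ j - 1))"
    using prod_power_ge_linear[of UNIV "\<lambda>j. x $ j" "\<lambda>j. \<alpha> $ j"]
    by (auto simp: mono_pow_def real_vec_def cbox_0_1_cart)
qed

lemma f_cvx_ge_tangent:
  assumes "S \<subseteq> cbox 0 1" "1 \<in> S" "\<And>\<beta> j. \<beta> \<in> B \<Longrightarrow> 0 \<le> \<beta> $ j" "real_vec \<alpha> \<in> B"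
    and x: "x \<in> cbox 0 1"
  shows "1 + (\<Sum>j\<in>UNIV. real (\<alpha> $ j) * (x $ j - 1)) \<le> f_cvx \<alpha> S B x"
proof -
  let ?g = "\<lambda>\<beta>. sigma \<alpha> S \<beta> + (\<Sum>j\<in>UNIV. \<beta> $ j * (x $ j - 1))"
  \<comment> \<open>This bound makes the real supremum dominate the cut for
    \<open>real_vec \<alpha>\<close>, even when \<open>B\<close> is unbounded.\<close>
  have "?g \<beta> \<le> 1" if "\<beta> \<in> B" for \<beta>
  proof -
    have "(\<Sum>j\<in>UNIV. \<beta> $ j * (x $ j - 1)) \<le> 0"
      using assms(3)[OF that] x by (intro sum_nonpos) (auto simp: cbox_0_1_cart mult_nonneg_nonpos)
    moreover have "sigma \<alpha> S \<beta> \<le> 1" using sigma_le_1 assms(1,2) assms(3)[OF that] by blast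
    ultimately show ?thesis by linarith
  qed
  then have "bdd_above (?g ` B)" by (intro bdd_aboveI2[where M = 1])
  then have "?g (real_vec \<alpha>) \<le> (SUP \<beta>\<in>B. ?g \<beta>)" using assms(4) by (intro cSUP_upper)
  moreover have "1 \<le> sigma \<alpha> S (real_vec \<alpha>)" using assms(1,2) by (intro sigma_real_vec_ge_1) auto
  ultimately show ?thesis by (simp add: f_cvx_def real_vec_def)
qed

text \<open>On the diagonal a cut depends on \<open>\<beta>\<close> only through
  \<open>sigma\<close> and the coordinate sum. That sum is at least 1 and
  \<open>t - 1 \<le> 0\<close>, so the cut is at most \<open>1 + (t - 1)\<close>.\<close>

lemma f_cvx_diagonal_le:
  fixes S B :: "(real ^ 'n) set"
  assumes "S \<subseteq> cbox 0 1" "1 \<in> S" "B \<noteq> {}" "\<And>\<beta> j. \<beta> \<in> B \<Longrightarrow> 1 \<le> \<beta> $ j" "0 \<le> t" "t \<le> 1"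
  shows "f_cvx \<alpha> S B (\<chi> j. t) \<le> t"
proof -
  have "sigma \<alpha> S \<beta> + (\<Sum>j\<in>UNIV. \<beta> $ j * ((\<chi> j. t) $ j - 1)) \<le> t" if "\<beta> \<in> B" for \<beta>
  proof -
    have \<beta>: "1 \<le> \<beta> $ j" for j using assms(4) that .
    have "(\<Sum>j\<in>(UNIV :: 'n set). 1) \<le> (\<Sum>j\<in>UNIV. \<beta> $ j)" using \<beta> by (intro sum_mono) auto
    moreover have "1 \<le> (\<Sum>j\<in>(UNIV :: 'n set). 1 :: real)" by (simp add: Suc_le_eq)
    ultimately have "1 \<le> (\<Sum>j\<in>UNIV. \<beta> $ j)" by linarith
    then have "(\<Sum>j\<in>UNIV. \<beta> $ j) * (t - 1) \<le> 1 * (t - 1)"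
      using assms(6) by (intro mult_right_mono_neg) auto
    moreover have "sigma \<alpha> S \<beta> \<le> 1"
      by (rule sigma_le_1[OF assms(1,2)]) (use \<beta> order_trans zero_le_one in blast)
    ultimately show ?thesis by (simp add: sum_distrib_right)
  qed
  then show ?thesis using assms(3,5) by (auto simp: f_cvx_def intro!: cSUP_least)
qed

section \<open>The largest gap over \<open>P_set\<close>\<close>

lemma P_set_gap_le:
  fixes \<alpha> :: "nat ^ 'n" and S B :: "(real ^ 'n) set"
  assumes d: "d = (\<Sum>j\<in>UNIV. \<alpha> $ j)" "2 \<le> d"
    and S: "S \<subseteq> cbox 0 1" "1 \<in> S"
    and B: "\<And>\<beta> j. \<beta> \<in> B \<Longrightarrow> 0 \<le> \<beta> $ j" "real_vec \<alpha> \<in> B"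
    and P: "(x, w) \<in> P_set \<alpha> S B"
  shows "\<bar>w - mono_pow x \<alpha>\<bar> \<le> (1 - 1 / real d) * real d powr (1 / (1 - real d))"
proof -
  have x: "x \<in> cbox 0 1" and w: "f_cvx \<alpha> S B x \<le> w" "w \<le> Min (range (($) x))"
    using P by (auto simp: P_set_def)
  have xj: "0 \<le> x $ j" "x $ j \<le> 1" for j using x by (auto simp: cbox_0_1_cart)
  define m where "m = Min (range (($) x))"
  have m: "m \<le> x $ j" for j by (simp add: m_def)
  have "m \<in> range (($) x)" unfolding m_def by (rule Min_in) auto
  then have m0: "0 \<le> m" using xj by auto
  have "m ^ d = (\<Prod>j\<in>UNIV. m ^ (\<alpha> $ j))" by (simp add: d(1) power_sum)
  also have "\<dots> \<le> mono_pow x \<alpha>"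
    unfolding mono_pow_def by (intro prod_mono conjI power_mono m m0 zero_le_power)
  finally have above: "w - mono_pow x \<alpha> \<le> (1 - 1 / real d) * real d powr (1 / (1 - real d))"
    using diff_power_le[OF d(2) m0] w(2) unfolding m_def by linarith
  \<comment> \<open>The weighted mean turns the cut for \<open>real_vec \<alpha>\<close> into a
    function of one variable.\<close>
  define u where "u = (\<Sum>j\<in>UNIV. real (\<alpha> $ j) * x $ j) / real d"
  have du: "real d * u = (\<Sum>j\<in>UNIV. real (\<alpha> $ j) * x $ j)" using d(2) by (simp add: u_def)
  have u0: "0 \<le> u" unfolding u_def by (intro divide_nonneg_nonneg sum_nonneg mult_nonneg_nonneg xj) auto
  have "(\<Sum>j\<in>UNIV. real (\<alpha> $ j) * x $ j) \<le> (\<Sum>j\<in>UNIV. real (\<alpha> $ j) * 1)"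
    by (intro sum_mono mult_left_mono xj) auto
  then have "real d * u \<le> real d * 1" unfolding du by (simp add: d(1))
  then have u1: "u \<le> 1" using d(2) by simp
  have "1 + (\<Sum>j\<in>UNIV. real (\<alpha> $ j) * (x $ j - 1)) = 1 - real d + real d * u"
    unfolding du by (simp add: d(1) algebra_simps sum_subtractf)
  moreover have "0 \<le> f_cvx \<alpha> S B x" by (simp add: f_cvx_def)
  ultimately have "max 0 (1 - real d + real d * u) \<le> w"
    using f_cvx_ge_tangent[OF S B x] w(1) by linarith
  moreover have "mono_pow x \<alpha> \<le> u ^ d"
  \<comment> \<open>AM-GM above divides by the mean. If the mean is 0, a coordinate with positive
    exponent vanishes, and the monomial with it.\<close>
  proof (cases "u = 0")
    case False
    then show ?thesis
      unfolding mono_pow_def using u0 du d(1) xj by (intro prod_power_le_mean_power) auto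
  next
    case True
    then have "\<And>j. real (\<alpha> $ j) * x $ j = 0"
      using du xj sum_nonneg_eq_0_iff[of UNIV "\<lambda>j. real (\<alpha> $ j) * x $ j"] by simp
    moreover obtain j where "\<alpha> $ j \<noteq> 0" using d by fastforce
    ultimately have "x $ j ^ (\<alpha> $ j) = 0" by (metis mult_eq_0_iff of_nat_eq_0_iff power_eq_0_iff neq0_conv)
    then have "mono_pow x \<alpha> = 0" by (auto simp: mono_pow_def)
    then show ?thesis using u0 by simp
  qed
  ultimately have "mono_pow x \<alpha> - w \<le> (1 - 1 / real d) * real d powr (1 / (1 - real d))"
    using power_diff_tangent_le[of d u] contact_power_le[OF d(2)] u0 u1 d(2) by linarith
  with above show ?thesis by linarith
qed

theorem proposition3p6:
  fixes \<alpha> :: "nat ^ 'n" and S B :: "(real ^ 'n) set" and d :: nat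
  assumes "CARD('n) \<ge> 2"
    and "\<And>j. \<alpha> $ j \<ge> 1"
    and "d = (\<Sum>j\<in>UNIV. \<alpha> $ j)"
    and "S \<subseteq> cbox 0 1" and "compact S" and "convex S" and "1 \<in> S"
    and "B \<subseteq> {1 + y | y. \<forall>j. 0 \<le> y $ j}"
    and "real_vec \<alpha> \<in> B"
  shows "(\<exists>(x, w)\<in>P_set \<alpha> S B. \<forall>(y, v)\<in>P_set \<alpha> S B.
            \<bar>v - mono_pow y \<alpha>\<bar> \<le> \<bar>w - mono_pow x \<alpha>\<bar>)
       \<and> mu \<alpha> (P_set \<alpha> S B) = (1 - 1 / real d) * real d powr (1 / (1 - real d))"
proof -
  define t where "t = real d powr (1 / (1 - real d))"
  let ?M = "(1 - 1 / real d) * t"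
  let ?gap = "\<lambda>(x, w). \<bar>w - mono_pow x \<alpha>\<bar>"
  have "(\<Sum>j\<in>(UNIV :: 'n set). 1) \<le> d" unfolding assms(3) by (intro sum_mono assms(2))
  then have d: "2 \<le> d" using assms(1) by simp
  have B: "1 \<le> \<beta> $ j" if "\<beta> \<in> B" for \<beta> j using assms(8) that by auto
  \<comment> \<open>The exponent \<open>1 / (1 - d)\<close> is negative and the base is at least 1,
    which puts the diagonal point in the cube.\<close>
  have "t \<le> real d powr 0"
    unfolding t_def using d by (intro powr_mono) (auto simp: divide_nonneg_neg)
  then have t: "0 \<le> t" "t \<le> 1" "t ^ d = t / real d"
    using d critical_point_power(2)[OF d] by (auto simp: t_def)
  let ?p = "((\<chi> j. t), t) :: (real ^ 'n) \<times> real"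
  have "f_cvx \<alpha> S B (\<chi> j. t) \<le> t"
    using assms(4,7,9) B t by (intro f_cvx_diagonal_le) auto
  then have p: "?p \<in> P_set \<alpha> S B"
    using t by (auto simp: P_set_def cbox_0_1_cart)
  have "mono_pow (\<chi> j. t) \<alpha> = t ^ d" by (simp add: mono_pow_def assms(3) power_sum)
  moreover have "t - t ^ d = ?M" using t by (simp add: algebra_simps)
  moreover have "0 \<le> ?M" using t d by simp
  ultimately have gap_p: "?gap ?p = ?M" by simp
  have "0 \<le> \<beta> $ j" if "\<beta> \<in> B" for \<beta> j using B[OF that, of j] by linarith
  then have gap_le: "?gap z \<le> ?M" if "z \<in> P_set \<alpha> S B" for z
    using P_set_gap_le[OF assms(3) d assms(4,7) _ assms(9)] that unfolding t_def by (cases z) auto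
  \<comment> \<open>The bound \<open>?M\<close> is attained at \<open>?p\<close>, so the supremum is
    a maximum.\<close>
  have "mu \<alpha> (P_set \<alpha> S B) = ?M"
    unfolding mu_def
    by (rule cSup_eq_maximum) (use p gap_p gap_le in \<open>force+\<close>)
  moreover have "\<exists>z\<in>P_set \<alpha> S B. \<forall>z'\<in>P_set \<alpha> S B. ?gap z' \<le> ?gap z"
    using p gap_p gap_le by metis
  ultimately show ?thesis by (force simp: t_def)
qed

end
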